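(* Let $p>0$, $T>0$, and let $f(x,t)$ be a given function. Then the boundary value problem (P) for the mixed parabolic-hyperbolic equation, described in the context, has at most one solution $u$ satisfying $$\lim_{x\to 0} x\,u_x(x,t)=0,\qquad \lim_{x\to p}(p-x)\,u_x(x,t)=0\qquad\text{for } -T<t<T .$$ That is, if $u_1$ and $u_2$ are two solutions of (P) (with the same $f$) both satisfying these limit conditions, then $u_1=u_2$ in $\overline\Omega$.
   Context: Let $\Omega=\{(x,t): 0<x<p,\ -T<t<T\}$, $\Omega^+=\Omega\cap\{t>0\}$, $\Omega^-=\Omega\cap\{t<0\}$. Problem (P): find a function $u\in C(\overline\Omega)\cap C^{2,2}_{x,t}(\Omega)$ (continuous on $\overline\Omega$, with continuous derivatives up to order two in $x$ and up to order two in $t$ in $\Omega$) which satisfies the equation $$u_{tt}-u_{xx}=f(x,t)\ \text{ in }\Omega^+,\qquad u_t+u_{xx}=f(x,t)\ \text{ in }\Omega^-,$$ the boundary conditions $$u(0,t)=0,\quad u(p,t)=0,\qquad -T<t<T,$$ and the conjugation conditions $$u(x,+0)=u(x,-0),\quad u_t(x,+0)=u_t(x,-0),\quad u_{tt}(x,+0)=u_{tt}(x,-0),\qquad 0<x<p,$$ where $\pm0$ denote the one-sided limits as $t\to0^{\pm}$. *)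

theory Defs
  imports "HOL-Analysis.Analysis"
begin

text \<open>Points of the plane are pairs \<open>(x, t)\<close>; functions are total on the plane, and
  everything below depends only on their values on \<open>closure (Omega p T)\<close>.\<close>

definition Omega :: "real \<Rightarrow> real \<Rightarrow> (real \<times> real) set" where
  "Omega p T = {0<..<p} \<times> {-T<..<T}"

definition Omega_pos :: "real \<Rightarrow> real \<Rightarrow> (real \<times> real) set" where
  "Omega_pos p T = Omega p T \<inter> {(x, t). t > 0}"

definition Omega_neg :: "real \<Rightarrow> real \<Rightarrow> (real \<times> real) set" where
  "Omega_neg p T = Omega p T \<inter> {(x, t). t < 0}"

definition Dx :: "(real \<times> real \<Rightarrow> real) \<Rightarrow> real \<times> real \<Rightarrow> real" where
  "Dx u = (\<lambda>(x, t). deriv (\<lambda>y. u (y, t)) x)"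

definition Dt :: "(real \<times> real \<Rightarrow> real) \<Rightarrow> real \<times> real \<Rightarrow> real" where
  "Dt u = (\<lambda>(x, t). deriv (\<lambda>s. u (x, s)) t)"

definition has_Dx_on :: "(real \<times> real \<Rightarrow> real) \<Rightarrow> (real \<times> real) set \<Rightarrow> bool" where
  "has_Dx_on u S \<longleftrightarrow> (\<forall>(x, t)\<in>S. (\<lambda>y. u (y, t)) differentiable (at x))"

definition has_Dt_on :: "(real \<times> real \<Rightarrow> real) \<Rightarrow> (real \<times> real) set \<Rightarrow> bool" where
  "has_Dt_on u S \<longleftrightarrow> (\<forall>(x, t)\<in>S. (\<lambda>s. u (x, s)) differentiable (at t))"

text \<open>The anisotropic class \<open>C\<close> with upper indices \<open>2, 2\<close>: only the pure derivatives
  \<open>u_x, u_xx, u_t, u_tt\<close> are required; nothing is assumed about \<open>u_xt\<close>.\<close>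

definition C22_on :: "(real \<times> real) set \<Rightarrow> (real \<times> real \<Rightarrow> real) \<Rightarrow> bool" where
  "C22_on S u \<longleftrightarrow>
     continuous_on S u \<and>
     has_Dx_on u S \<and> continuous_on S (Dx u) \<and>
     has_Dx_on (Dx u) S \<and> continuous_on S (Dx (Dx u)) \<and>
     has_Dt_on u S \<and> continuous_on S (Dt u) \<and>
     has_Dt_on (Dt u) S \<and> continuous_on S (Dt (Dt u))"

text \<open>\<open>g(x, +0) = g(x, -0)\<close>, including the existence of both one-sided limits.\<close>

definition conjugate_at :: "(real \<times> real \<Rightarrow> real) \<Rightarrow> real \<Rightarrow> bool" where
  "conjugate_at g x \<longleftrightarrow>
     (\<exists>L. ((\<lambda>t. g (x, t)) \<longlongrightarrow> L) (at_right 0) \<and> ((\<lambda>t. g (x, t)) \<longlongrightarrow> L) (at_left 0))"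

definition solves_P ::
    "real \<Rightarrow> real \<Rightarrow> (real \<times> real \<Rightarrow> real) \<Rightarrow> (real \<times> real \<Rightarrow> real) \<Rightarrow> bool" where
  "solves_P p T f u \<longleftrightarrow>
     continuous_on (closure (Omega p T)) u \<and>
     C22_on (Omega p T) u \<and>
     (\<forall>z\<in>Omega_pos p T. Dt (Dt u) z - Dx (Dx u) z = f z) \<and>
     (\<forall>z\<in>Omega_neg p T. Dt u z + Dx (Dx u) z = f z) \<and>
     (\<forall>t\<in>{-T<..<T}. u (0, t) = 0 \<and> u (p, t) = 0) \<and>
     (\<forall>x\<in>{0<..<p}. conjugate_at u x \<and> conjugate_at (Dt u) x \<and> conjugate_at (Dt (Dt u)) x)"

definition lateral_limits :: "real \<Rightarrow> real \<Rightarrow> (real \<times> real \<Rightarrow> real) \<Rightarrow> bool" where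
  "lateral_limits p T u \<longleftrightarrow>
     (\<forall>t\<in>{-T<..<T}.
        ((\<lambda>x. x * Dx u (x, t)) \<longlongrightarrow> 0) (at_right 0) \<and>
        ((\<lambda>x. (p - x) * Dx u (x, t)) \<longlongrightarrow> 0) (at_left p))"

end

theory Submission
  imports Defs
begin

text \<open>
  The difference \<open>u\<close> of two solutions solves the homogeneous problem, and the point is to show that
  its trace \<open>\<phi> = u (\<sqdot>, 0)\<close> on the line of type change vanishes. By continuity both equations hold on
  that line, so there \<open>u_tt = u_xx = \<phi>''\<close> and \<open>u_t = - \<phi>''\<close>. If the parabolic equation could be
  differentiated in \<open>t\<close>, it would give \<open>(u_t)_xx = - u_tt = - \<phi>''\<close>; an integrated version of this
  argument (\<open>trace_plus_velocity_affine\<close>) shows that \<open>\<phi> + u_t (\<sqdot>, 0) = \<phi> - \<phi>''\<close> is an affine function.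
  This is a linear equation of fourth order for \<open>\<phi>\<close>, and the lateral conditions \<open>\<phi> = 0\<close> at the two ends
  leave a two-dimensional space of solutions, so two more conditions are needed.

  They come from the hyperbolic side. If \<open>u_t (x, 0)\<close> did not tend to zero as \<open>x\<close> approaches an
  endpoint, it would clash with the zero lateral condition at the corner, and the clash would travel
  along the characteristic from that corner as a jump of the first derivatives of \<open>u\<close> inside the
  domain. The required interior regularity excludes this (\<open>ut_vanishes_at_corner\<close>). To argue on
  characteristics without the mixed derivative \<open>u_xt\<close>, the wave is paired with its conjugate
  \<open>w\<close>, where \<open>w_x = u_t\<close> and \<open>w_t = u_x\<close>; then \<open>u - w\<close> and \<open>u + w\<close> are constant along the two
  families of characteristics, and the zero lateral condition turns one into the negative of the other
  (\<open>reflection\<close>).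

  The affine function therefore has limit zero at both ends and vanishes identically, so
  \<open>u_t (\<sqdot>, 0) = - \<phi>\<close> and \<open>\<phi>'' = \<phi>\<close> with zero boundary values; hence \<open>\<phi> = 0\<close> and \<open>u_t (\<sqdot>, 0) = 0\<close>.
  For \<open>t > 0\<close> the wave has zero Cauchy data and vanishes by following characteristics and their
  reflections. For \<open>t < 0\<close> the equation is the heat equation in the time \<open>- t\<close> with zero initial and
  lateral values, and \<open>u\<close> vanishes by the maximum principle. Continuity extends the equality to the
  closed rectangle.
\<close>

section \<open>Derivatives along lines\<close>

text \<open>Continuity of only one of the two partial derivatives suffices for total differentiability
  at a point. This asymmetric form matters: for the conjugate wave below, the \<open>t\<close>-derivative
  is identified only for \<open>t \<ge> 0\<close>, hence not on a neighbourhood of points with \<open>t = 0\<close>.\<close>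
lemma DERIV_along_line:
  fixes f fx :: "real \<times> real \<Rightarrow> real"
  assumes "open S" and S: "(x + a * r, t + b * r) \<in> S"
    and fx: "\<And>y s. (y, s) \<in> S \<Longrightarrow> ((\<lambda>y. f (y, s)) has_real_derivative fx (y, s)) (at y)"
    and cont: "continuous_on S fx"
    and ft: "((\<lambda>s. f (x + a * r, s)) has_real_derivative d) (at (t + b * r))"
  shows "((\<lambda>r. f (x + a * r, t + b * r)) has_real_derivative
           a * fx (x + a * r, t + b * r) + b * d) (at r)"
proof -
  define x0 t0 where "x0 = x + a * r" and "t0 = t + b * r"
  obtain X Y where XY: "open X" "open Y" "(x0, t0) \<in> X \<times> Y" "X \<times> Y \<subseteq> S"
    using open_prod_elim[OF assms(1,2)] unfolding x0_def t0_def by metis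
  then obtain e where e: "e > 0" "ball x0 e \<subseteq> X"
    using openE[of X x0] by auto
  have sub: "ball x0 e \<times> Y \<subseteq> S"
    using Sigma_mono[OF e(2), of "\<lambda>_. Y" "\<lambda>_. Y"] XY(4) by (auto dest: subsetD)
  have "((\<lambda>(s, y). f (y, s)) has_derivative
          (\<lambda>(ts, ty). d * ts + blinfun_mult_right (fx (x0, t0)) ty)) (at (t0, x0) within Y \<times> ball x0 e)"
  proof (rule has_derivative_partialsI[where fy = "\<lambda>s y. blinfun_mult_right (fx (y, s))"])
    show "((\<lambda>s. f (x0, s)) has_derivative (\<lambda>ts. d * ts)) (at t0 within Y)"
      using ft unfolding x0_def t0_def has_field_derivative_def
      by (rule has_derivative_at_withinI)
    show "((\<lambda>y. f (y, s)) has_derivative blinfun_apply (blinfun_mult_right (fx (y, s))))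
            (at y within ball x0 e)" if "s \<in> Y" "y \<in> ball x0 e" for s y
    proof -
      have "(y, s) \<in> S" using that sub by blast
      from fx[OF this] show ?thesis
        unfolding has_field_derivative_def by (simp add: has_derivative_at_withinI)
    qed
    have "continuous_on (Y \<times> ball x0 e) (\<lambda>z. blinfun_mult_right (fx (snd z, fst z)))"
      using sub by (intro continuous_intros continuous_on_compose2[OF cont]) auto
    then have "continuous (at (t0, x0) within Y \<times> ball x0 e) (\<lambda>z. blinfun_mult_right (fx (snd z, fst z)))"
      unfolding continuous_on_eq_continuous_within by (rule bspec) (use XY e in auto)
    then show "continuous (at (t0, x0) within Y \<times> ball x0 e)
        (\<lambda>(s, y). blinfun_mult_right (fx (y, s)))"
      unfolding case_prod_unfold .
  qed (use XY e in auto)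
  moreover have "at (t0, x0) within Y \<times> ball x0 e = at (t0, x0)"
    using XY e by (intro at_within_open open_Times) auto
  ultimately have *: "((\<lambda>(s, y). f (y, s)) has_derivative (\<lambda>(ts, ty). d * ts + fx (x0, t0) * ty))
      (at (t + b * r, x + a * r))"
    unfolding x0_def t0_def by simp
  have "((\<lambda>r. (t + b * r, x + a * r)) has_derivative (\<lambda>h. (b * h, a * h))) (at r)"
    by (auto intro!: derivative_eq_intros)
  from has_derivative_compose[OF this *, unfolded prod.case]
  show ?thesis
    unfolding has_field_derivative_def
    by (rule has_derivative_eq_rhs) (auto simp: x0_def t0_def algebra_simps)
qed

section \<open>Integrals with a movable endpoint on either side\<close>

text \<open>The derivatives of a solution need not be integrable up to the lateral boundary, so
  primitives are based at an interior point \<open>c\<close> and are needed on both sides of it. Since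
  \<open>{c..x}\<close> is empty or a point when \<open>x \<le> c\<close>, at most one of the two integrals counts.\<close>
definition oriented_integral :: "real \<Rightarrow> real \<Rightarrow> (real \<Rightarrow> real) \<Rightarrow> real" where
  "oriented_integral c x h = integral {c..x} h - integral {x..c} h"

lemma oriented_integral_eq:
  assumes "continuous_on {a..b} h" "c \<in> {a..b}" "x \<in> {a..b}"
  shows "oriented_integral c x h = integral {a..x} h - integral {a..c} h"
proof -
  have int: "h integrable_on {a..y}" if "y \<in> {a..b}" for y
    using that assms by (intro integrable_continuous_real) (auto intro: continuous_on_subset)
  show ?thesis
  proof (cases "c \<le> x")
    case True
    then show ?thesis
      using Henstock_Kurzweil_Integration.integral_combine[of a c x h] int[of x] assms
      by (cases "c = x") (auto simp: oriented_integral_def)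
  next
    case False
    then show ?thesis
      using Henstock_Kurzweil_Integration.integral_combine[of a x c h] int[of c] assms
      by (auto simp: oriented_integral_def)
  qed
qed

lemma DERIV_oriented_integral:
  assumes cont: "continuous_on {a<..<b} h" and "c \<in> {a<..<b}" "x \<in> {a<..<b}"
  shows "((\<lambda>x. oriented_integral c x h) has_real_derivative h x) (at x)"
proof -
  obtain a' where a': "a < a'" "a' < c" "a' < x"
    using assms dense[of a "min c x"] by auto
  obtain b' where b': "b' < b" "c < b'" "x < b'"
    using assms dense[of "max c x" b] by auto
  have cont': "continuous_on {a'..b'} h"
    using a' b' by (intro continuous_on_subset[OF cont]) auto
  have "((\<lambda>x. integral {a'..x} h) has_real_derivative h x) (at x within {a'..b'})"
    using a' b' by (intro integral_has_real_derivative cont') auto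
  then have "((\<lambda>x. integral {a'..x} h) has_real_derivative h x) (at x)"
    using a' b' by (simp add: at_within_Icc_at)
  then have "((\<lambda>x. integral {a'..x} h - integral {a'..c} h) has_real_derivative h x) (at x)"
    by (auto intro!: derivative_eq_intros)
  then show ?thesis
  proof (rule has_field_derivative_transform_within_open)
    show "x \<in> {a'<..<b'}" using a' b' by auto
    show "integral {a'..y} h - integral {a'..c} h = oriented_integral c y h"
      if "y \<in> {a'<..<b'}" for y
      using that a' b' by (intro oriented_integral_eq[OF cont', symmetric]) auto
  qed auto
qed

lemma oriented_integral_FTC:
  assumes "\<And>y. y \<in> {a<..<b} \<Longrightarrow> (F has_real_derivative h y) (at y)"
    and "c \<in> {a<..<b}" "x \<in> {a<..<b}"
  shows "oriented_integral c x h = F x - F c"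
proof -
  have *: "(h has_integral F d - F e) {e..d}" if "e \<le> d" "e \<in> {a<..<b}" "d \<in> {a<..<b}" for d e
    using that assms(1)
    by (intro fundamental_theorem_of_calculus)
       (auto simp flip: has_real_derivative_iff_has_vector_derivative intro: has_field_derivative_at_within)
  show ?thesis
    using *[of c x] *[of x c] assms(2,3)
    by (cases x c rule: linorder_cases) (auto simp: oriented_integral_def dest!: integral_unique)
qed

lemma oriented_integral_cong:
  assumes "\<And>y. y \<in> {a<..<b} \<Longrightarrow> h y = k y" and "c \<in> {a<..<b}" "x \<in> {a<..<b}"
  shows "oriented_integral c x h = oriented_integral c x k"
proof -
  have "integral {d..e} h = integral {d..e} k" if "d \<in> {a<..<b}" "e \<in> {a<..<b}" for d e
    by (rule Henstock_Kurzweil_Integration.integral_cong) (use assms(1) that in auto)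
  then show ?thesis
    using assms(2,3) by (simp add: oriented_integral_def)
qed

lemma DERIV_oriented_integral_parameter:
  fixes h h' :: "real \<times> real \<Rightarrow> real"
  assumes h': "\<And>y s. y \<in> {a<..<b} \<Longrightarrow> s \<in> {t1<..<t2} \<Longrightarrow>
                  ((\<lambda>s. h (y, s)) has_real_derivative h' (y, s)) (at s)"
    and cont: "continuous_on ({a<..<b} \<times> {t1<..<t2}) h"
    and cont': "continuous_on ({a<..<b} \<times> {t1<..<t2}) h'"
    and c: "c \<in> {a<..<b}" and x: "x \<in> {a<..<b}" and t: "t \<in> {t1<..<t2}"
  shows "((\<lambda>s. oriented_integral c x (\<lambda>y. h (y, s))) has_real_derivative
           oriented_integral c x (\<lambda>y. h' (y, t))) (at t)"
proof -
  have *: "((\<lambda>s. integral {d..e} (\<lambda>y. h (y, s))) has_real_derivative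
           integral {d..e} (\<lambda>y. h' (y, t))) (at t)"
    if "d \<in> {a<..<b}" "e \<in> {a<..<b}" for d e
  proof -
    have "((\<lambda>s. integral (cbox d e) (\<lambda>y. h (y, s))) has_real_derivative
           integral (cbox d e) (\<lambda>y. h' (y, t))) (at t within {t1<..<t2})"
    proof (rule leibniz_rule_field_derivative)
      show "((\<lambda>s. h (y, s)) has_real_derivative h' (y, s)) (at s within {t1<..<t2})"
        if "s \<in> {t1<..<t2}" "y \<in> cbox d e" for s y
        using h'[of y s] that \<open>d \<in> _\<close> \<open>e \<in> _\<close> by (auto intro: has_field_derivative_at_within)
      show "(\<lambda>y. h (y, s)) integrable_on cbox d e" if "s \<in> {t1<..<t2}" for s
        using that \<open>d \<in> _\<close> \<open>e \<in> _\<close>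
        by (intro integrable_continuous continuous_on_compose2[OF cont] continuous_intros) auto
      show "continuous_on ({t1<..<t2} \<times> cbox d e) (\<lambda>(s, y). h' (y, s))"
        using \<open>d \<in> _\<close> \<open>e \<in> _\<close> unfolding split_beta
        by (intro continuous_on_compose2[OF cont'] continuous_intros) auto
    qed (use t in auto)
    then show ?thesis
      using t by (simp add: at_within_open[of t "{t1<..<t2}"])
  qed
  show ?thesis
    unfolding oriented_integral_def by (intro DERIV_diff * c x)
qed

section \<open>Maximum principles\<close>
lemma second_derivative_nonpos_at_max:
  fixes f f' :: "real \<Rightarrow> real"
  assumes x: "x \<in> {a<..<b}"
    and f': "\<And>y. y \<in> {a<..<b} \<Longrightarrow> (f has_real_derivative f' y) (at y)"
    and f'': "(f' has_real_derivative D) (at x)"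
    and max: "\<And>y. y \<in> {a<..<b} \<Longrightarrow> f y \<le> f x"
  shows "D \<le> 0"
proof (rule ccontr)
  assume "\<not> D \<le> 0"
  then obtain d where d: "d > 0" "\<And>h. h > 0 \<Longrightarrow> h < d \<Longrightarrow> f' x < f' (x + h)"
    using DERIV_pos_inc_right[OF f''] by auto
  have "f' x = 0"
    using x by (intro DERIV_local_max[OF f'[OF x], of "min (x - a) (b - x)"]) (auto intro!: max)
  define y where "y = x + min d (b - x) / 2"
  have y: "x < y" "y < x + d" "y < b"
    using d x by (auto simp: y_def min_def field_simps)
  have "f x < f y"
  proof (rule DERIV_pos_imp_increasing_open[OF y(1)])
    show "\<exists>D. (f has_real_derivative D) (at z) \<and> D > 0" if "x < z" "z < y" for z
      using f'[of z] d(2)[of "z - x"] that y x \<open>f' x = 0\<close> by (intro exI[of _ "f' z"]) auto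
    show "continuous_on {x..y} f"
      using x y by (intro DERIV_continuous_on[where D = f'])
        (auto intro!: has_field_derivative_at_within f')
  qed
  with max[of y] x y show False by auto
qed

text \<open>At a positive interior maximum, \<open>f'' = f > 0\<close> would contradict the second derivative
  test.\<close>
lemma nonpos_if_second_derivative_eq_self:
  fixes f f' :: "real \<Rightarrow> real"
  assumes cont: "continuous_on {0..p} f"
    and f': "\<And>x. x \<in> {0<..<p} \<Longrightarrow> (f has_real_derivative f' x) (at x)"
    and f'': "\<And>x. x \<in> {0<..<p} \<Longrightarrow> (f' has_real_derivative f x) (at x)"
    and "f 0 \<le> 0" "f p \<le> 0" and x: "x \<in> {0..p}"
  shows "f x \<le> 0"
proof -
  obtain y where y: "y \<in> {0..p}" "\<And>z. z \<in> {0..p} \<Longrightarrow> f z \<le> f y"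
    using continuous_attains_sup[OF _ _ cont] x by auto
  have "f y \<le> 0"
  proof (cases "y = 0 \<or> y = p")
    case False
    then have "y \<in> {0<..<p}" using y(1) by auto
    then show ?thesis
      using f' f'' y(2) by (intro second_derivative_nonpos_at_max[of y 0 p f f']) auto
  qed (use assms(4,5) in auto)
  with y(2)[OF x] show ?thesis by simp
qed

text \<open>The equation \<open>u_t + u_xx = 0\<close> is the heat equation run in the direction of decreasing
  \<open>t\<close>, so the data at \<open>t = 0\<close> and on the lateral sides control \<open>u\<close> for \<open>t < 0\<close>. The usual
  perturbation by \<open>e * t\<close> makes the inequality at an interior maximum strict. The maximum may lie
  at the lowest time \<open>t0\<close>; there the one-sided comparison with later times is enough.\<close>
lemma backward_heat_nonpos:
  fixes u ux uxx ut :: "real \<times> real \<Rightarrow> real"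
  assumes cont: "continuous_on ({0..p} \<times> {t0..0}) u"
    and ux: "\<And>x t. x \<in> {0<..<p} \<Longrightarrow> t \<in> {t0..<0} \<Longrightarrow> ((\<lambda>y. u (y, t)) has_real_derivative ux (x, t)) (at x)"
    and uxx: "\<And>x t. x \<in> {0<..<p} \<Longrightarrow> t \<in> {t0..<0} \<Longrightarrow> ((\<lambda>y. ux (y, t)) has_real_derivative uxx (x, t)) (at x)"
    and ut: "\<And>x t. x \<in> {0<..<p} \<Longrightarrow> t \<in> {t0..<0} \<Longrightarrow> ((\<lambda>s. u (x, s)) has_real_derivative ut (x, t)) (at t)"
    and heat: "\<And>x t. x \<in> {0<..<p} \<Longrightarrow> t \<in> {t0..<0} \<Longrightarrow> ut (x, t) + uxx (x, t) = 0"
    and lateral: "\<And>t. t \<in> {t0..0} \<Longrightarrow> u (0, t) \<le> 0" "\<And>t. t \<in> {t0..0} \<Longrightarrow> u (p, t) \<le> 0"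
    and top: "\<And>x. x \<in> {0..p} \<Longrightarrow> u (x, 0) \<le> 0"
    and x: "x \<in> {0..p}" and t: "t \<in> {t0..0}"
  shows "u (x, t) \<le> 0"
proof (rule ccontr)
  assume pos: "\<not> u (x, t) \<le> 0"
  \<comment> \<open>Small enough that the perturbed function is still positive at \<open>(x, t)\<close>.\<close>
  define e where "e = u (x, t) / (1 - t0)"
  have e: "e > 0" "e * (- t) < u (x, t)"
  proof -
    show "e > 0" using pos t by (auto simp: e_def)
    then have "e * (- t) < e * (1 - t0)"
      using t by (intro mult_strict_left_mono) auto
    then show "e * (- t) < u (x, t)" using t by (simp add: e_def)
  qed
  define v where "v = (\<lambda>z. u z + e * snd z)"
  have "continuous_on ({0..p} \<times> {t0..0}) v"
    unfolding v_def by (intro continuous_intros cont)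
  moreover have "compact ({0..p} \<times> {t0..0})" by (intro compact_Times compact_Icc)
  ultimately obtain z where z: "z \<in> {0..p} \<times> {t0..0}"
    "\<And>z'. z' \<in> {0..p} \<times> {t0..0} \<Longrightarrow> v z' \<le> v z"
    using continuous_attains_sup[of "{0..p} \<times> {t0..0}" v] x t by auto
  obtain y s where ys: "z = (y, s)" by (cases z)
  have max: "v (y', s') \<le> v (y, s)" if "y' \<in> {0..p}" "s' \<in> {t0..0}" for y' s'
    using z(2)[of "(y', s')"] that unfolding ys by auto
  have "v (x, t) > 0" using e(2) by (simp add: v_def)
  with max[OF x t] have v_pos: "v (y, s) > 0" by simp
  have s: "s \<in> {t0..0}" and y: "y \<in> {0..p}" using z(1) ys by auto
  have "e * s \<le> 0" using e s by (auto simp: mult_nonneg_nonpos)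
  with v_pos have u_pos: "u (y, s) > 0" by (simp add: v_def)
  have y': "y \<in> {0<..<p}" using u_pos lateral[OF s] y by (cases "y = 0 \<or> y = p") auto
  have s': "s \<in> {t0..<0}" using u_pos top[OF y] s by (cases "s = 0") auto
  have "uxx (y, s) \<le> 0"
  proof (rule second_derivative_nonpos_at_max[OF y'])
    show "((\<lambda>y. u (y, s)) has_real_derivative ux (x, s)) (at x)" if "x \<in> {0<..<p}" for x
      using ux[OF that s'] .
    show "u (x, s) \<le> u (y, s)" if "x \<in> {0<..<p}" for x
      using max[of x s] that s by (auto simp: v_def)
  qed (use uxx[OF y' s'] in auto)
  then have "ut (y, s) + e > 0" using heat[OF y' s'] e by linarith
  moreover have "((\<lambda>s. v (y, s)) has_real_derivative (ut (y, s) + e)) (at s)"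
    unfolding v_def by (auto intro!: derivative_eq_intros ut[OF y' s'])
  ultimately obtain d where d: "d > 0" "\<And>h. h > 0 \<Longrightarrow> h < d \<Longrightarrow> v (y, s) < v (y, s + h)"
    using DERIV_pos_inc_right[of "\<lambda>s. v (y, s)"] by blast
  define h where "h = min d (- s) / 2"
  have "h > 0" "h < d" "s + h \<in> {t0..0}" using d(1) s' by (auto simp: h_def)
  with d(2)[of h] max[OF y, of "s + h"] show False by auto
qed

section \<open>Waves through their characteristics\<close>

text \<open>A wave \<open>u\<close> on \<open>0 < x < p\<close>, \<open>0 \<le> t < T\<close> that vanishes on the lateral sides, together with
  a conjugate wave \<open>w\<close>, that is \<open>w_x = u_t\<close> and \<open>w_t = u_x\<close>. Then \<open>u - w\<close> depends on
  \<open>x - t\<close> only and \<open>u + w\<close> on \<open>x + t\<close> only: twice the two travelling waves of d'Alembert's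
  formula. The locale records these consequences instead of the \<open>t\<close>-derivatives. No differentiability
  up to the lateral boundary is available, so neither is any limit of \<open>w\<close> there.\<close>
locale wave_pair =
  fixes p T :: real and u w ux ut :: "real \<times> real \<Rightarrow> real"
  assumes p_pos: "p > 0" and T_pos: "T > 0"
    and cont_u: "continuous_on ({0..p} \<times> {0..<T}) u"
    and lateral: "\<And>t. t \<in> {0..<T} \<Longrightarrow> u (0, t) = 0" "\<And>t. t \<in> {0..<T} \<Longrightarrow> u (p, t) = 0"
    and DERIV_u: "\<And>x t. x \<in> {0<..<p} \<Longrightarrow> t \<in> {0..<T} \<Longrightarrow>
                     ((\<lambda>y. u (y, t)) has_real_derivative ux (x, t)) (at x)"
    and DERIV_w: "\<And>x t. x \<in> {0<..<p} \<Longrightarrow> t \<in> {0..<T} \<Longrightarrow>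
                     ((\<lambda>y. w (y, t)) has_real_derivative ut (x, t)) (at x)"
    and cont_ux: "\<And>t. t \<in> {0..<T} \<Longrightarrow> continuous_on {0<..<p} (\<lambda>x. ux (x, t))"
    and cont_ut: "\<And>t. t \<in> {0..<T} \<Longrightarrow> continuous_on {0<..<p} (\<lambda>x. ut (x, t))"
    and outgoing: "\<And>x t r. 0 \<le> r \<Longrightarrow> r \<le> t \<Longrightarrow> t < T \<Longrightarrow> 0 < x - r \<Longrightarrow> x < p \<Longrightarrow>
                     u (x, t) - w (x, t) = u (x - r, t - r) - w (x - r, t - r)"
    and incoming: "\<And>x t r. 0 \<le> r \<Longrightarrow> r \<le> t \<Longrightarrow> t < T \<Longrightarrow> 0 < x \<Longrightarrow> x + r < p \<Longrightarrow>
                     u (x, t) + w (x, t) = u (x + r, t - r) + w (x + r, t - r)"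
begin

text \<open>The reflection \<open>x \<mapsto> p - x\<close> exchanges the two families of characteristics, whence
  the sign of the conjugate wave. Statements about the left end of the interval thereby
  transfer to the right end.\<close>
lemma mirror: "wave_pair p T (\<lambda>z. u (p - fst z, snd z)) (\<lambda>z. - w (p - fst z, snd z))
                  (\<lambda>z. - ux (p - fst z, snd z)) (\<lambda>z. ut (p - fst z, snd z))"
proof
  fix x t :: real assume *: "x \<in> {0<..<p}" "t \<in> {0..<T}"
  then have *: "p - x \<in> {0<..<p}" "t \<in> {0..<T}" by auto
  have "((\<lambda>y. p - y) has_real_derivative -1) (at x)" by (auto intro!: derivative_eq_intros)
  from DERIV_chain2[OF DERIV_u[OF *] this] DERIV_chain2[OF DERIV_w[OF *] this]
  show "((\<lambda>y. u (p - fst (y, t), snd (y, t))) has_real_derivative - ux (p - fst (x, t), snd (x, t))) (at x)"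
    and "((\<lambda>y. - w (p - fst (y, t), snd (y, t))) has_real_derivative ut (p - fst (x, t), snd (x, t))) (at x)"
    by (auto dest: DERIV_minus)
next
  fix t :: real assume t: "t \<in> {0..<T}"
  show "continuous_on {0<..<p} (\<lambda>x. - ux (p - fst (x, t), snd (x, t)))"
       "continuous_on {0<..<p} (\<lambda>x. ut (p - fst (x, t), snd (x, t)))"
    by (auto intro!: continuous_intros continuous_on_compose2[OF cont_ux[OF t]]
        continuous_on_compose2[OF cont_ut[OF t]])
next
  fix x t r :: real assume "0 \<le> r" "r \<le> t" "t < T" "0 < x - r" "x < p"
  then show "u (p - fst (x, t), snd (x, t)) - - w (p - fst (x, t), snd (x, t)) =
       u (p - fst (x - r, t - r), snd (x - r, t - r)) - - w (p - fst (x - r, t - r), snd (x - r, t - r))"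
    using incoming[of r t "p - x"] by (simp add: algebra_simps)
next
  fix x t r :: real assume "0 \<le> r" "r \<le> t" "t < T" "0 < x" "x + r < p"
  then show "u (p - fst (x, t), snd (x, t)) + - w (p - fst (x, t), snd (x, t)) =
       u (p - fst (x + r, t - r), snd (x + r, t - r)) + - w (p - fst (x + r, t - r), snd (x + r, t - r))"
    using outgoing[of r t "p - x"] by (simp add: algebra_simps)
next
  show "continuous_on ({0..p} \<times> {0..<T}) (\<lambda>z. u (p - fst z, snd z))"
    by (intro continuous_on_compose2[OF cont_u] continuous_intros) auto
qed (use p_pos T_pos lateral in auto)

text \<open>Follow the characteristic through \<open>(x, t)\<close> down to just before it hits the side
  \<open>x = 0\<close> at time \<open>t - x\<close>, and from there the other characteristic down to time \<open>t0\<close>, which it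
  reaches near \<open>(t - x - t0, t0)\<close>. Since \<open>u\<close> tends to zero at the side, \<open>u - w\<close> turns into
  \<open>- (u + w)\<close>: the wave is reflected with a change of sign.\<close>
lemma reflection:
  assumes "0 \<le> t0" "0 < x" "x < p" "t < T" and d: "0 < t - x - t0" "t - x - t0 < p"
  shows "u (x, t) - w (x, t) = - (u (t - x - t0, t0) + w (t - x - t0, t0))"
proof -
  \<comment> \<open>\<open>u - w = 2 * u - (u + w)\<close> at \<open>(x - r, t - r)\<close>, with \<open>u + w\<close> transported to time \<open>t0\<close>.
      In this form it is continuous up to \<open>r = x\<close>, although nothing is known about \<open>w\<close> there.\<close>
  define g where "g = (\<lambda>r. 2 * u (x - r, t - r) - (u (x + t - t0 - 2 * r, t0) + w (x + t - t0 - 2 * r, t0)))"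
  obtain r0 where r0: "max 0 ((x + t - t0 - p) / 2) < r0" "r0 < x"
    using dense[of "max 0 ((x + t - t0 - p) / 2)" x] assms by auto
  have t0: "t0 \<in> {0..<T}" using assms by auto
  have cont_w: "continuous_on {0<..<p} (\<lambda>x. w (x, t0))"
    using DERIV_w[OF _ t0] by (meson DERIV_isCont continuous_at_imp_continuous_on)
  have "continuous_on {r0..x} g"
    unfolding g_def using r0 assms
    by (intro continuous_intros continuous_on_compose2[OF cont_u] continuous_on_compose2[OF cont_w]) auto
  moreover have "g r = u (x, t) - w (x, t)" if "r \<in> {r0<..<x}" for r
  proof -
    have "u (x, t) - w (x, t) = u (x - r, t - r) - w (x - r, t - r)"
      using that r0 assms by (intro outgoing) auto
    moreover have "u (x - r, t - r) + w (x - r, t - r) =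
        u (x - r + (t - r - t0), t - r - (t - r - t0)) + w (x - r + (t - r - t0), t - r - (t - r - t0))"
      using that r0 assms by (intro incoming) auto
    ultimately show ?thesis by (simp add: g_def algebra_simps)
  qed
  moreover have "closure {r0<..<x} = {r0..x}" using r0 by simp
  ultimately have "g x = u (x, t) - w (x, t)"
    using continuous_constant_on_closure[of "{r0<..<x}" g "u (x, t) - w (x, t)" x] r0(2) by simp
  moreover have "u (0, t - x) = 0" using assms by (intro lateral) auto
  ultimately show ?thesis by (simp add: g_def algebra_simps)
qed

text \<open>The interior regularity of \<open>u\<close> forces this compatibility condition at the corner
  \<open>(0, 0)\<close>. At a fixed time \<open>\<tau>\<close>, the function \<open>k = (u - w)_x = u_x - u_t\<close> is continuous in
  \<open>x\<close> across the characteristic \<open>x = t\<close> that starts at the corner. To the right of \<open>x = \<tau>\<close> it equals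
  \<open>u_x - u_t\<close> at \<open>(s, 0)\<close>, by transport; to the left it equals \<open>u_x + u_t\<close> at \<open>(s, 0)\<close>, by
  reflection. The two values can only match as \<open>s\<close> tends to zero if \<open>u_t (s, 0)\<close> does.\<close>
lemma ut_vanishes_at_corner: "((\<lambda>x. ut (x, 0)) \<longlongrightarrow> 0) (at_right 0)"
proof -
  define \<tau> where "\<tau> = min p T / 2"
  define k where "k = (\<lambda>x. ux (x, \<tau>) - ut (x, \<tau>))"
  have \<tau>: "0 < \<tau>" "\<tau> < T" "2 * \<tau> \<le> p" "\<tau> \<in> {0..<T}" "0 \<in> {0..<T}"
    using p_pos T_pos by (auto simp: \<tau>_def)
  have jump: "ut (s, 0) = (k (\<tau> - s) - k (\<tau> + s)) / 2" if s: "s \<in> {0<..<\<tau>}" for s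
  proof -
    have mem: "s \<in> {0<..<p}" "\<tau> - s \<in> {0<..<p}" "\<tau> + s \<in> {0<..<p}" using s \<tau> by auto
    have plus: "((\<lambda>s. \<tau> + s) has_real_derivative 1) (at s)"
      and minus: "((\<lambda>s. \<tau> - s) has_real_derivative -1) (at s)"
      by (auto intro!: derivative_eq_intros)
    have right: "((\<lambda>s. u (\<tau> + s, \<tau>) - w (\<tau> + s, \<tau>)) has_real_derivative k (\<tau> + s)) (at s)"
      using DERIV_diff[OF DERIV_chain2[OF DERIV_u[OF mem(3) \<tau>(4)] plus]
          DERIV_chain2[OF DERIV_w[OF mem(3) \<tau>(4)] plus]] by (simp add: k_def)
    have left: "((\<lambda>s. u (\<tau> - s, \<tau>) - w (\<tau> - s, \<tau>)) has_real_derivative - k (\<tau> - s)) (at s)"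
      using DERIV_diff[OF DERIV_chain2[OF DERIV_u[OF mem(2) \<tau>(4)] minus]
          DERIV_chain2[OF DERIV_w[OF mem(2) \<tau>(4)] minus]] by (simp add: k_def)
    have "((\<lambda>s. u (s, 0) - w (s, 0)) has_real_derivative k (\<tau> + s)) (at s)"
    proof (rule has_field_derivative_transform_within_open[OF right _ s])
      show "u (\<tau> + s, \<tau>) - w (\<tau> + s, \<tau>) = u (s, 0) - w (s, 0)" if "s \<in> {0<..<\<tau>}" for s
        using outgoing[of \<tau> \<tau> "\<tau> + s"] that \<tau> by simp
    qed auto
    moreover have "((\<lambda>s. u (s, 0) - w (s, 0)) has_real_derivative ux (s, 0) - ut (s, 0)) (at s)"
      by (intro DERIV_diff DERIV_u DERIV_w mem \<tau>)
    ultimately have *: "k (\<tau> + s) = ux (s, 0) - ut (s, 0)" by (rule DERIV_unique)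
    have "((\<lambda>s. - (u (s, 0) + w (s, 0))) has_real_derivative - k (\<tau> - s)) (at s)"
    proof (rule has_field_derivative_transform_within_open[OF left _ s])
      show "u (\<tau> - s, \<tau>) - w (\<tau> - s, \<tau>) = - (u (s, 0) + w (s, 0))" if "s \<in> {0<..<\<tau>}" for s
        using reflection[of 0 "\<tau> - s" \<tau>] that \<tau> by simp
    qed auto
    moreover have "((\<lambda>s. - (u (s, 0) + w (s, 0))) has_real_derivative - (ux (s, 0) + ut (s, 0))) (at s)"
      by (intro DERIV_minus DERIV_add DERIV_u DERIV_w mem \<tau>)
    ultimately have "- k (\<tau> - s) = - (ux (s, 0) + ut (s, 0))" by (rule DERIV_unique)
    with * show ?thesis by simp
  qed
  have "isCont k \<tau>"
    using continuous_on_diff[OF cont_ux[OF \<tau>(4)] cont_ut[OF \<tau>(4)]] \<tau>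
    unfolding k_def by (subst (asm) continuous_on_eq_continuous_at) auto
  moreover have "((\<lambda>s. \<tau> - s) \<longlongrightarrow> \<tau>) (at_right 0)" "((\<lambda>s. \<tau> + s) \<longlongrightarrow> \<tau>) (at_right 0)"
    by (auto intro!: tendsto_eq_intros)
  ultimately have "((\<lambda>s. k (\<tau> - s)) \<longlongrightarrow> k \<tau>) (at_right 0)" "((\<lambda>s. k (\<tau> + s)) \<longlongrightarrow> k \<tau>) (at_right 0)"
    by (simp_all only: isCont_tendsto_compose)
  from tendsto_divide[OF tendsto_diff[OF this] tendsto_const[of 2]]
  have "((\<lambda>s. (k (\<tau> - s) - k (\<tau> + s)) / 2) \<longlongrightarrow> 0) (at_right 0)"
    by simp
  then show ?thesis
    by (rule Lim_transform_eventually)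
       (use jump \<tau> in \<open>auto simp: eventually_at_right_field intro!: exI[of _ \<tau>]\<close>)
qed

text \<open>Constancy propagates for a time less than \<open>p\<close>, during which a characteristic meets the
  left side at most once. A point whose characteristic emanates from the corner
  \<open>(0, t0)\<close> is reached neither by transport nor by reflection, and is treated by continuity in \<open>x\<close>.\<close>
lemma outgoing_constant_step:
  assumes H: "\<And>x. x \<in> {0<..<p} \<Longrightarrow> u (x, t0) - w (x, t0) = - k"
    and K: "\<And>x. x \<in> {0<..<p} \<Longrightarrow> u (x, t0) + w (x, t0) = k"
    and t: "0 \<le> t0" "t0 \<le> t" "t < t0 + p" "t < T" and x: "x \<in> {0<..<p}"
  shows "u (x, t) - w (x, t) = - k"
proof -
  have off: "u (x, t) - w (x, t) = - k" if "x \<noteq> t - t0" "x \<in> {0<..<p}" for x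
  proof (cases "x > t - t0")
    case True
    then show ?thesis
      using outgoing[of "t - t0" t x] H[of "x - (t - t0)"] t that by simp
  next
    case False
    then show ?thesis
      using reflection[of t0 x t] K[of "t - x - t0"] t that by simp
  qed
  have "isCont (\<lambda>x. u (x, t) - w (x, t)) x"
    using DERIV_isCont[OF DERIV_u[OF x]] DERIV_isCont[OF DERIV_w[OF x]] t
    by (intro continuous_intros) auto
  moreover have "((\<lambda>x. u (x, t) - w (x, t)) \<longlongrightarrow> - k) (at x)"
  proof (cases "x = t - t0")
    case True
    have "\<forall>\<^sub>F y in at x. u (y, t) - w (y, t) = - k"
      using eventually_at_in_open[of "{0<..<p}" x] x
      by (auto elim!: eventually_mono intro!: off simp: True)
    then show ?thesis by (rule tendsto_eventually)
  next
    case False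
    have "open ({0<..<p} - {t - t0})" by (intro open_Diff) auto
    then have "\<forall>\<^sub>F y in at x. y \<in> {0<..<p} - {t - t0}"
      using x False by (intro eventually_at_in_open') auto
    then have "\<forall>\<^sub>F y in at x. u (y, t) - w (y, t) = - k"
      by eventually_elim (auto intro: off)
    then show ?thesis by (rule tendsto_eventually)
  qed
  ultimately show ?thesis
    unfolding isCont_def by (rule tendsto_unique[OF at_neq_bot])
qed

text \<open>With zero Cauchy data, \<open>w (x, 0)\<close> is a constant \<open>k\<close>, so \<open>u - w = - k\<close> and
  \<open>u + w = k\<close> initially. Both identities survive each time step, the second through the mirror image
  of the first.\<close>
lemma wave_vanishes:
  assumes u0: "\<And>x. x \<in> {0<..<p} \<Longrightarrow> u (x, 0) = 0"
    and ut0: "\<And>x. x \<in> {0<..<p} \<Longrightarrow> ut (x, 0) = 0"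
    and x: "x \<in> {0<..<p}" and t: "t \<in> {0..<T}"
  shows "u (x, t) = 0"
proof -
  interpret m: wave_pair p T "\<lambda>z. u (p - fst z, snd z)" "\<lambda>z. - w (p - fst z, snd z)"
    "\<lambda>z. - ux (p - fst z, snd z)" "\<lambda>z. ut (p - fst z, snd z)"
    by (rule mirror)
  have "\<exists>k. \<forall>x\<in>{0<..<p}. w (x, 0) = k"
  proof (rule has_field_derivative_zero_constant)
    show "((\<lambda>x. w (x, 0)) has_real_derivative 0) (at x within {0<..<p})" if "x \<in> {0<..<p}" for x
      using DERIV_w[OF that, of 0] ut0[OF that] T_pos by (auto intro: has_field_derivative_at_within)
  qed auto
  then obtain k where k: "\<And>x. x \<in> {0<..<p} \<Longrightarrow> w (x, 0) = k" by auto
  \<comment> \<open>Steps of length \<open>p / 2\<close> stay strictly below the length \<open>p\<close> that a single step bridges.\<close>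
  have "\<forall>t x. 0 \<le> t \<longrightarrow> t \<le> real n * (p / 2) \<longrightarrow> t < T \<longrightarrow> x \<in> {0<..<p} \<longrightarrow>
          u (x, t) - w (x, t) = - k \<and> u (x, t) + w (x, t) = k" for n
  proof (induction n)
    case 0
    then show ?case using u0 k by auto
  next
    case (Suc n)
    show ?case
    proof (intro allI impI)
      fix t x assume t: "0 \<le> t" "t \<le> real (Suc n) * (p / 2)" "t < T" and x: "x \<in> {0<..<p}"
      define t0 where "t0 = min t (real n * (p / 2))"
      have t0: "0 \<le> t0" "t0 \<le> real n * (p / 2)" "t0 \<le> t" "t0 < T" "t < t0 + p"
        using t p_pos by (auto simp: t0_def min_def algebra_simps)
      have IH: "u (x, t0) - w (x, t0) = - k" "u (x, t0) + w (x, t0) = k" if "x \<in> {0<..<p}" for x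
        using Suc.IH t0 that by auto
      have px: "p - y \<in> {0<..<p}" if "y \<in> {0<..<p}" for y using that by auto
      have "u (x, t) - w (x, t) = - k"
        using t t0 by (intro outgoing_constant_step[OF IH] x) auto
      moreover have "u (p - fst (p - x, t), snd (p - x, t)) - (- w (p - fst (p - x, t), snd (p - x, t))) = - (- k)"
      proof (rule m.outgoing_constant_step[of t0])
        fix y assume "y \<in> {0<..<p}"
        from IH[OF px[OF this]]
        show "u (p - fst (y, t0), snd (y, t0)) - (- w (p - fst (y, t0), snd (y, t0))) = - (- k)"
          and "u (p - fst (y, t0), snd (y, t0)) + - w (p - fst (y, t0), snd (y, t0)) = - k"
          by simp_all
      qed (use t t0 px[OF x] in auto)
      ultimately show "u (x, t) - w (x, t) = - k \<and> u (x, t) + w (x, t) = k"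
        by simp
    qed
  qed
  moreover obtain n where "t / (p / 2) < real n" using reals_Archimedean2 by blast
  then have "t \<le> real n * (p / 2)" using p_pos by (simp add: field_simps)
  ultimately have "u (x, t) - w (x, t) = - k \<and> u (x, t) + w (x, t) = k" 
    using x t by (meson atLeastLessThan_iff)
  then show ?thesis by linarith
qed

end

section \<open>The homogeneous mixed problem\<close>
lemma DERIV_eq_0_if_vanishes_on_left:
  fixes f :: "real \<Rightarrow> real"
  assumes der: "(f has_real_derivative D) (at a)" and "b < a"
    and zero: "\<And>x. b < x \<Longrightarrow> x \<le> a \<Longrightarrow> f x = 0"
  shows "D = 0"
proof (rule ccontr)
  assume "D \<noteq> 0"
  then consider "D > 0" | "D < 0" by linarith
  then obtain d where d: "d > 0" "\<And>h. h > 0 \<Longrightarrow> h < d \<Longrightarrow> f (a - h) \<noteq> f a"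
  proof cases
    case 1
    then show ?thesis using DERIV_pos_inc_left[OF der] that by (metis less_irrefl)
  next
    case 2
    then show ?thesis using DERIV_neg_dec_left[OF der] that by (metis less_irrefl)
  qed
  define h where "h = min d (a - b) / 2"
  have "h > 0" "h < d" "h < a - b" using d(1) \<open>b < a\<close> by (auto simp: h_def)
  with d(2)[of h] zero[of "a - h"] zero[of a] \<open>b < a\<close> show False by auto
qed

locale homogeneous_solution =
  fixes p T :: real and u ux uxx ut utt :: "real \<times> real \<Rightarrow> real"
  assumes p_pos: "p > 0" and T_pos: "T > 0"
    and cont_u: "continuous_on ({0..p} \<times> {-T<..<T}) u"
    and lateral: "\<And>t. t \<in> {-T<..<T} \<Longrightarrow> u (0, t) = 0" "\<And>t. t \<in> {-T<..<T} \<Longrightarrow> u (p, t) = 0"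
    and ux: "\<And>x t. x \<in> {0<..<p} \<Longrightarrow> t \<in> {-T<..<T} \<Longrightarrow> ((\<lambda>y. u (y, t)) has_real_derivative ux (x, t)) (at x)"
    and uxx: "\<And>x t. x \<in> {0<..<p} \<Longrightarrow> t \<in> {-T<..<T} \<Longrightarrow> ((\<lambda>y. ux (y, t)) has_real_derivative uxx (x, t)) (at x)"
    and ut: "\<And>x t. x \<in> {0<..<p} \<Longrightarrow> t \<in> {-T<..<T} \<Longrightarrow> ((\<lambda>s. u (x, s)) has_real_derivative ut (x, t)) (at t)"
    and utt: "\<And>x t. x \<in> {0<..<p} \<Longrightarrow> t \<in> {-T<..<T} \<Longrightarrow> ((\<lambda>s. ut (x, s)) has_real_derivative utt (x, t)) (at t)"
    and cont_ux: "continuous_on ({0<..<p} \<times> {-T<..<T}) ux"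
    and cont_uxx: "continuous_on ({0<..<p} \<times> {-T<..<T}) uxx"
    and cont_ut: "continuous_on ({0<..<p} \<times> {-T<..<T}) ut"
    and cont_utt: "continuous_on ({0<..<p} \<times> {-T<..<T}) utt"
    and wave: "\<And>x t. x \<in> {0<..<p} \<Longrightarrow> t \<in> {0<..<T} \<Longrightarrow> utt (x, t) = uxx (x, t)"
    and heat: "\<And>x t. x \<in> {0<..<p} \<Longrightarrow> t \<in> {-T<..<0} \<Longrightarrow> ut (x, t) = - uxx (x, t)"
begin

lemma continuous_on_vertical:
  assumes "continuous_on ({0<..<p} \<times> {-T<..<T}) g" "x \<in> {0<..<p}"
  shows "continuous_on {-T<..<T} (\<lambda>t. g (x, t :: real) :: real)"
  by (rule continuous_on_compose2[OF assms(1), where f = "\<lambda>t. (x, t)"])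
     (use assms(2) in \<open>auto intro!: continuous_intros\<close>)

lemma continuous_on_horizontal:
  assumes "continuous_on ({0<..<p} \<times> {-T<..<T}) g" "t \<in> {-T<..<T}"
  shows "continuous_on {0<..<p} (\<lambda>x. g (x, t :: real) :: real)"
  by (rule continuous_on_compose2[OF assms(1), where f = "\<lambda>x. (x, t)"])
     (use assms(2) in \<open>auto intro!: continuous_intros\<close>)

text \<open>Both equations persist on the line \<open>t = 0\<close>, since all the derivatives involved are continuous
  across it. Having them both there is what couples the two halves of the domain.\<close>
lemma wave_closed:
  assumes x: "x \<in> {0<..<p}" and t: "t \<in> {0..<T}"
  shows "utt (x, t) = uxx (x, t)"
proof -
  have cont: "continuous_on {-T<..<T} (\<lambda>t. utt (x, t) - uxx (x, t))"
    by (intro continuous_on_diff continuous_on_vertical cont_utt cont_uxx x)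
  have "utt (x, 0) - uxx (x, 0) = 0"
  proof (rule continuous_constant_on_closure[of "{0<..<T/2}" "\<lambda>t. utt (x, t) - uxx (x, t)"])
    show "continuous_on (closure {0<..<T/2}) (\<lambda>t. utt (x, t) - uxx (x, t))"
      using T_pos by (intro continuous_on_subset[OF cont]) auto
    show "utt (x, t) - uxx (x, t) = 0" if "t \<in> {0<..<T/2}" for t
      using wave[OF x, of t] that by auto
  qed (use T_pos in auto)
  then show ?thesis using wave[OF x, of t] t by (cases "t = 0") auto
qed

lemma heat_closed:
  assumes x: "x \<in> {0<..<p}" and t: "t \<in> {-T<..0}"
  shows "ut (x, t) = - uxx (x, t)"
proof -
  have cont: "continuous_on {-T<..<T} (\<lambda>t. ut (x, t) + uxx (x, t))"
    by (intro continuous_on_add continuous_on_vertical cont_ut cont_uxx x)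
  have "ut (x, 0) + uxx (x, 0) = 0"
  proof (rule continuous_constant_on_closure[of "{-T/2<..<0}" "\<lambda>t. ut (x, t) + uxx (x, t)"])
    show "continuous_on (closure {-T/2<..<0}) (\<lambda>t. ut (x, t) + uxx (x, t))"
      using T_pos by (intro continuous_on_subset[OF cont]) auto
    show "ut (x, t) + uxx (x, t) = 0" if "t \<in> {-T/2<..<0}" for t
      using heat[OF x, of t] that T_pos by auto
  qed (use T_pos in auto)
  then show ?thesis using heat[OF x, of t] t by (cases "t = 0") auto
qed

text \<open>For a solution of the wave equation the form \<open>u_t dx + u_x dt\<close> is closed, and this is its
  potential. Unlike factoring the wave operator, this makes no use of the mixed derivative \<open>u_xt\<close>.
  The integration path runs first along \<open>x = p / 2\<close> from time \<open>0\<close>, then horizontally, so that the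
  formula makes sense on the whole domain even though the form is closed only for \<open>t \<ge> 0\<close>.\<close>
definition conjugate_wave :: "real \<times> real \<Rightarrow> real" where
  "conjugate_wave z = oriented_integral (p / 2) (fst z) (\<lambda>y. ut (y, snd z)) +
                      oriented_integral 0 (snd z) (\<lambda>s. ux (p / 2, s))"

lemma DERIV_conjugate_wave_x:
  assumes x: "x \<in> {0<..<p}" and t: "t \<in> {-T<..<T}"
  shows "((\<lambda>y. conjugate_wave (y, t)) has_real_derivative ut (x, t)) (at x)"
proof -
  have "p / 2 \<in> {0<..<p}" using p_pos by simp
  from DERIV_add[OF DERIV_oriented_integral[OF continuous_on_horizontal[OF cont_ut t] this x] DERIV_const]
  show ?thesis by (simp add: conjugate_wave_def)
qed

lemma DERIV_conjugate_wave_t: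
  assumes x: "x \<in> {0<..<p}" and t: "t \<in> {0..<T}"
  shows "((\<lambda>s. conjugate_wave (x, s)) has_real_derivative ux (x, t)) (at t)"
proof -
  have c: "p / 2 \<in> {0<..<p}" and t': "t \<in> {-T<..<T}" and "0 \<in> {-T<..<T}"
    using p_pos T_pos t by auto
  have "oriented_integral (p / 2) x (\<lambda>y. utt (y, t)) = oriented_integral (p / 2) x (\<lambda>y. uxx (y, t))"
    using wave_closed t by (intro oriented_integral_cong[of 0 p] c x) auto
  also have "\<dots> = ux (x, t) - ux (p / 2, t)"
    by (rule oriented_integral_FTC[of 0 p, OF uxx[OF _ t'] c x])
  finally have "oriented_integral (p / 2) x (\<lambda>y. utt (y, t)) + ux (p / 2, t) = ux (x, t)" by simp
  moreover have "((\<lambda>s. oriented_integral (p / 2) x (\<lambda>y. ut (y, s))) has_real_derivative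
      oriented_integral (p / 2) x (\<lambda>y. utt (y, t))) (at t)"
    by (rule DERIV_oriented_integral_parameter[OF utt cont_ut cont_utt c x t'])
  moreover have "((\<lambda>t. oriented_integral 0 t (\<lambda>s. ux (p / 2, s))) has_real_derivative ux (p / 2, t)) (at t)"
    by (rule DERIV_oriented_integral[OF continuous_on_vertical[OF cont_ux c]]) fact+
  ultimately show ?thesis
    unfolding conjugate_wave_def by (auto intro!: derivative_eq_intros)
qed

text \<open>Along the direction \<open>(\<sigma>, 1)\<close> the derivative of \<open>u - \<sigma> * w\<close> is
  \<open>\<sigma> u_x + u_t - \<sigma> (\<sigma> u_t + u_x)\<close>, which is zero for \<open>\<sigma> = 1\<close> and \<open>\<sigma> = -1\<close>.\<close>
lemma characteristic_constant:
  assumes \<sigma>: "\<sigma> = 1 \<or> \<sigma> = -1" and r: "0 \<le> r" "r \<le> t" "t < T"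
    and x: "x \<in> {0<..<p}" "x - \<sigma> * r \<in> {0<..<p}"
  shows "u (x, t) - \<sigma> * conjugate_wave (x, t) =
         u (x - \<sigma> * r, t - r) - \<sigma> * conjugate_wave (x - \<sigma> * r, t - r)"
proof -
  define S where "S = {0<..<p} \<times> {-T<..<T}"
  have "open S" unfolding S_def by (intro open_Times) auto
  let ?f = "\<lambda>q. u (x - \<sigma> * q, t - q) - \<sigma> * conjugate_wave (x - \<sigma> * q, t - q)"
  have "(?f has_real_derivative 0) (at q)" if q: "q \<in> {0..r}" for q
  proof -
    have xq: "x - \<sigma> * q \<in> {0<..<p}" and tq: "t - q \<in> {0..<T}" "t - q \<in> {-T<..<T}"
      using \<sigma> q r x T_pos by auto
    have mem: "(x + (- \<sigma>) * q, t + (- 1) * q) \<in> S"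
      using xq tq by (auto simp: S_def)
    have "((\<lambda>q. u (x + (- \<sigma>) * q, t + (- 1) * q)) has_real_derivative
            (- \<sigma>) * ux (x + (- \<sigma>) * q, t + (- 1) * q) + (- 1) * ut (x + (- \<sigma>) * q, t + (- 1) * q)) (at q)"
      using ux ut mem xq tq cont_ux by (intro DERIV_along_line[OF \<open>open S\<close>]) (auto simp: S_def)
    moreover have "((\<lambda>q. conjugate_wave (x + (- \<sigma>) * q, t + (- 1) * q)) has_real_derivative
            (- \<sigma>) * ut (x + (- \<sigma>) * q, t + (- 1) * q) + (- 1) * ux (x + (- \<sigma>) * q, t + (- 1) * q)) (at q)"
      using DERIV_conjugate_wave_x DERIV_conjugate_wave_t mem xq tq cont_ut
      by (intro DERIV_along_line[OF \<open>open S\<close>]) (auto simp: S_def)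
    ultimately show ?thesis
      using \<sigma> by (auto intro!: derivative_eq_intros)
  qed
  then have "\<exists>k. \<forall>q\<in>{0..r}. ?f q = k"
    by (intro has_field_derivative_zero_constant) (auto intro: has_field_derivative_at_within)
  then obtain k where k: "\<And>q. q \<in> {0..r} \<Longrightarrow> ?f q = k" by blast
  have "?f 0 = k" "?f r = k" using k[of 0] k[of r] r(1) by simp_all
  then show ?thesis by simp
qed

lemma wave_pair: "wave_pair p T u conjugate_wave ux ut"
proof
  show "u (x, t) - conjugate_wave (x, t) = u (x - r, t - r) - conjugate_wave (x - r, t - r)"
    if "0 \<le> r" "r \<le> t" "t < T" "0 < x - r" "x < p" for x t r
    using characteristic_constant[of 1 r t x] that by simp
  show "u (x, t) + conjugate_wave (x, t) = u (x + r, t - r) + conjugate_wave (x + r, t - r)"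
    if "0 \<le> r" "r \<le> t" "t < T" "0 < x" "x + r < p" for x t r
    using characteristic_constant[of "-1" r t x] that by simp
  show "continuous_on ({0..p} \<times> {0..<T}) u"
    using T_pos by (intro continuous_on_subset[OF cont_u]) auto
  show "continuous_on {0<..<p} (\<lambda>x. ux (x, t))" "continuous_on {0<..<p} (\<lambda>x. ut (x, t))"
    if "t \<in> {0..<T}" for t
    using that T_pos by (auto intro!: continuous_on_horizontal cont_ux cont_ut)
qed (use p_pos T_pos lateral ux DERIV_conjugate_wave_x in auto)

sublocale wave: wave_pair p T u conjugate_wave ux ut
  by (rule wave_pair)

sublocale mirrored: wave_pair p T "\<lambda>z. u (p - fst z, snd z)" "\<lambda>z. - conjugate_wave (p - fst z, snd z)"
    "\<lambda>z. - ux (p - fst z, snd z)" "\<lambda>z. ut (p - fst z, snd z)"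
  by (rule wave.mirror)

text \<open>Write \<open>\<phi> = u (\<sqdot>, 0)\<close>. On \<open>t = 0\<close> the equations say \<open>u_tt = u_xx = \<phi>''\<close>, while a formal
  \<open>t\<close>-derivative of the parabolic equation says \<open>(u_t)_xx = - u_tt\<close>; together
  \<open>(\<phi> + u_t)_xx = 0\<close>. The derivative \<open>u_xxt\<close> need not exist, so the parabolic
  equation is first integrated twice in \<open>x\<close>: with
  \<open>E x t = \<integral> (x - y) u_t (y, t) dy + u (x, t) - u (c, t)\<close>, the integral running from \<open>c\<close> to \<open>x\<close>, it
  reads \<open>E x t = (x - c) u_x (c, t)\<close> for \<open>t \<le> 0\<close>. The left side is differentiable in \<open>t\<close> at
  \<open>0\<close>, and its derivative \<open>E' x\<close> contains \<open>\<phi> x + u_t (x, 0)\<close>.\<close>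
lemma trace_plus_velocity_affine:
  obtains \<alpha> \<beta> where "\<And>x. x \<in> {0<..<p} \<Longrightarrow> u (x, 0) + ut (x, 0) = \<alpha> + \<beta> * x"
proof -
  define c where "c = p / 2"
  have c: "c \<in> {0<..<p}" using p_pos by (auto simp: c_def)
  have zero: "0 \<in> {-T<..<T}" using T_pos by auto
  define E where "E = (\<lambda>x t. oriented_integral c x (\<lambda>y. (x - y) * ut (y, t)) + u (x, t) - u (c, t))"
  define E' where "E' = (\<lambda>x. u (x, 0) - u (c, 0) - (x - c) * ux (c, 0) + ut (x, 0) - ut (c, 0))"
  have by_parts: "oriented_integral c x (\<lambda>y. (x - y) * uxx (y, t)) = u (x, t) - u (c, t) - (x - c) * ux (c, t)"
    if x: "x \<in> {0<..<p}" and t: "t \<in> {-T<..<T}" for x t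
  proof -
    have "oriented_integral c x (\<lambda>y. (x - y) * uxx (y, t)) =
            ((x - x) * ux (x, t) + u (x, t)) - ((x - c) * ux (c, t) + u (c, t))"
      by (rule oriented_integral_FTC[of 0 p, OF _ c x])
         (auto intro!: derivative_eq_intros ux uxx simp: t[simplified])
    then show ?thesis by simp
  qed
  have E: "E x t = (x - c) * ux (c, t)" if x: "x \<in> {0<..<p}" and t: "t \<in> {-T<..0}" for x t
  proof -
    have "oriented_integral c x (\<lambda>y. (x - y) * ut (y, t)) = - oriented_integral c x (\<lambda>y. (x - y) * uxx (y, t))"
    proof -
      have "oriented_integral c x (\<lambda>y. (x - y) * ut (y, t)) = oriented_integral c x (\<lambda>y. - ((x - y) * uxx (y, t)))"
        using heat_closed t by (intro oriented_integral_cong[OF _ c x]) auto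
      then show ?thesis by (simp add: oriented_integral_def)
    qed
    then show ?thesis using by_parts[OF x, of t] t T_pos by (simp add: E_def)
  qed
  have DERIV_E: "((\<lambda>t. E x t) has_real_derivative E' x) (at 0)" if x: "x \<in> {0<..<p}" for x
  proof -
    have "((\<lambda>t. oriented_integral c x (\<lambda>y. (x - fst (y, t)) * ut (y, t))) has_real_derivative
            oriented_integral c x (\<lambda>y. (x - fst (y, 0 :: real)) * utt (y, 0))) (at 0)"
      by (rule DERIV_oriented_integral_parameter[where h = "\<lambda>z. (x - fst z) * ut z"
              and h' = "\<lambda>z. (x - fst z) * utt z", OF _ _ _ c x zero])
         (auto intro!: derivative_eq_intros continuous_intros utt cont_ut cont_utt)
    moreover have "oriented_integral c x (\<lambda>y. (x - fst (y, 0 :: real)) * utt (y, 0)) =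
        oriented_integral c x (\<lambda>y. (x - y) * uxx (y, 0))"
      using wave_closed T_pos by (intro oriented_integral_cong[OF _ c x]) auto
    ultimately have "((\<lambda>t. oriented_integral c x (\<lambda>y. (x - y) * ut (y, t))) has_real_derivative
        u (x, 0) - u (c, 0) - (x - c) * ux (c, 0)) (at 0)"
      using by_parts[OF x zero] by simp
    then show ?thesis
      unfolding E_def E'_def by (auto intro!: derivative_eq_intros ut x c zero[simplified])
  qed
  \<comment> \<open>Comparing with a second point \<open>e\<close> eliminates \<open>u_x (c, t)\<close>, whose \<open>t\<close>-derivative is not known
      to exist beforehand.\<close>
  define e where "e = 3 * p / 4"
  have e: "e \<in> {0<..<p}" "e - c = p / 4" using p_pos by (auto simp: e_def c_def)
  have E'_linear: "(e - c) * E' x = (x - c) * E' e" if x: "x \<in> {0<..<p}" for x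
  proof -
    have "(e - c) * E' x - (x - c) * E' e = 0"
    proof (rule DERIV_eq_0_if_vanishes_on_left)
      show "((\<lambda>t. (e - c) * E x t - (x - c) * E e t) has_real_derivative
              (e - c) * E' x - (x - c) * E' e) (at 0)"
        by (auto intro!: derivative_eq_intros DERIV_E x e)
      show "(e - c) * E x t - (x - c) * E e t = 0" if "- T < t" "t \<le> 0" for t
        using that E[OF x, of t] E[OF e(1), of t] by simp
    qed (use T_pos in auto)
    then show ?thesis by simp
  qed
  define m where "m = E' e / (e - c) + ux (c, 0)"
  have "u (x, 0) + ut (x, 0) = (u (c, 0) + ut (c, 0) - m * c) + m * x" if x: "x \<in> {0<..<p}" for x
  proof -
    have "E' x = (x - c) * (E' e / (e - c))"
    proof -
      have "e - c \<noteq> 0" using e(2) p_pos by simp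
      then show ?thesis
        using E'_linear[OF x] nonzero_eq_divide_eq[of "e - c" "E' x" "(x - c) * E' e"]
        by (simp add: mult.commute)
    qed
    then have "E' x + (x - c) * ux (c, 0) = (x - c) * m"
      by (simp add: m_def algebra_simps)
    then show ?thesis by (simp add: E'_def algebra_simps)
  qed
  then show ?thesis by (rule that)
qed

text \<open>The affine function \<open>u (x, 0) + u_t (x, 0)\<close> tends to zero at both ends: the first summand by
  the boundary condition, the second by the compatibility condition at the corners.\<close>
lemma velocity_eq_minus_trace:
  assumes x: "x \<in> {0<..<p}"
  shows "ut (x, 0) = - u (x, 0)"
proof -
  obtain \<alpha> \<beta> where ab: "\<And>x. x \<in> {0<..<p} \<Longrightarrow> u (x, 0) + ut (x, 0) = \<alpha> + \<beta> * x"
    using trace_plus_velocity_affine by blast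
  have cont: "continuous_on {0..p} (\<lambda>x. u (x, 0))"
    using T_pos by (intro continuous_on_compose2[OF cont_u] continuous_intros) auto
  have lat: "u (0, 0) = 0" "u (p, 0) = 0" using lateral[of 0] T_pos by auto
  have "((\<lambda>x. u (x, 0)) \<longlongrightarrow> 0) (at_right 0)"
    using continuous_on_Icc_at_rightD[OF cont p_pos] lat by simp
  from tendsto_add[OF this wave.ut_vanishes_at_corner]
  have lim0: "((\<lambda>x. u (x, 0) + ut (x, 0)) \<longlongrightarrow> 0) (at_right 0)" by simp
  have "((\<lambda>x. \<alpha> + \<beta> * x) \<longlongrightarrow> \<alpha>) (at_right 0)"
    by (auto intro!: tendsto_eq_intros)
  then have "((\<lambda>x. u (x, 0) + ut (x, 0)) \<longlongrightarrow> \<alpha>) (at_right 0)"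
    by (rule Lim_transform_eventually)
       (use ab p_pos in \<open>auto simp: eventually_at_right_field intro!: exI[of _ p]\<close>)
  from tendsto_unique[OF trivial_limit_at_right_real this lim0] have \<alpha>: "\<alpha> = 0" .
  have cont': "continuous_on {0..p} (\<lambda>x. u (p - x, 0))"
    by (intro continuous_on_compose2[OF cont] continuous_intros) auto
  have "((\<lambda>x. u (p - x, 0)) \<longlongrightarrow> 0) (at_right 0)"
    using continuous_on_Icc_at_rightD[OF cont' p_pos] lat by simp
  from tendsto_add[OF this mirrored.ut_vanishes_at_corner]
  have limp: "((\<lambda>x. u (p - x, 0) + ut (p - x, 0)) \<longlongrightarrow> 0) (at_right 0)" by simp
  have "((\<lambda>x. \<alpha> + \<beta> * (p - x)) \<longlongrightarrow> \<alpha> + \<beta> * p) (at_right 0)"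
    by (auto intro!: tendsto_eq_intros)
  then have "((\<lambda>x. u (p - x, 0) + ut (p - x, 0)) \<longlongrightarrow> \<alpha> + \<beta> * p) (at_right 0)"
    by (rule Lim_transform_eventually)
       (use ab p_pos in \<open>auto simp: eventually_at_right_field intro!: exI[of _ p]\<close>)
  from tendsto_unique[OF trivial_limit_at_right_real this limp] have "\<alpha> + \<beta> * p = 0" .
  with \<alpha> p_pos ab[OF x] show ?thesis by simp
qed

text \<open>The trace \<open>\<phi> = u (\<sqdot>, 0)\<close> now satisfies \<open>\<phi>'' = u_xx = - u_t = \<phi>\<close> and vanishes at both
  ends.\<close>
lemma trace_vanishes:
  assumes x: "x \<in> {0..p}"
  shows "u (x, 0) = 0"
proof -
  have zero: "0 \<in> {-T<..<T}" using T_pos by auto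
  have cont: "continuous_on {0..p} (\<lambda>x. u (x, 0))"
    using T_pos by (intro continuous_on_compose2[OF cont_u] continuous_intros) auto
  have uxx0: "((\<lambda>x. ux (x, 0)) has_real_derivative u (x, 0)) (at x)" if "x \<in> {0<..<p}" for x
    using uxx[OF that zero] heat_closed[OF that, of 0] velocity_eq_minus_trace[OF that] T_pos by simp
  have "u (x, 0) \<le> 0"
    by (rule nonpos_if_second_derivative_eq_self[OF cont ux[OF _ zero] uxx0]) (use lateral zero x in auto)
  moreover have "- u (x, 0) \<le> 0"
    by (rule nonpos_if_second_derivative_eq_self[where f = "\<lambda>x. - u (x, 0)" and f' = "\<lambda>x. - ux (x, 0)" and p = p])
       (use lateral zero x in \<open>auto intro!: continuous_intros cont DERIV_minus ux uxx0\<close>)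
  ultimately show ?thesis by simp
qed

lemma vanishes_after:
  assumes "x \<in> {0<..<p}" "t \<in> {0..<T}"
  shows "u (x, t) = 0"
proof (rule wave.wave_vanishes[OF _ _ assms])
  show "u (y, 0) = 0" "ut (y, 0) = 0" if "y \<in> {0<..<p}" for y
    using that trace_vanishes[of y] velocity_eq_minus_trace[of y] by simp_all
qed

lemma vanishes_before:
  assumes x: "x \<in> {0<..<p}" and t: "t \<in> {-T<..0}"
  shows "u (x, t) = 0"
proof -
  have cont: "continuous_on ({0..p} \<times> {t..0}) u"
    using t T_pos by (intro continuous_on_subset[OF cont_u]) auto
  \<comment> \<open>Both signs of \<open>\<sigma>\<close> are used: the problem is linear and the maximum principle one-sided.\<close>
  have nonpos: "\<sigma> * u (x, t) \<le> 0" for \<sigma>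
  proof (rule backward_heat_nonpos[of p t "\<lambda>z. \<sigma> * u z" "\<lambda>z. \<sigma> * ux z" "\<lambda>z. \<sigma> * uxx z" "\<lambda>z. \<sigma> * ut z"])
    show "continuous_on ({0..p} \<times> {t..0}) (\<lambda>z. \<sigma> * u z)"
      by (intro continuous_on_mult continuous_on_const cont)
    fix y s
    show "s \<in> {t..0} \<Longrightarrow> \<sigma> * u (0, s) \<le> 0" "s \<in> {t..0} \<Longrightarrow> \<sigma> * u (p, s) \<le> 0"
      using lateral[of s] t T_pos by auto
    show "y \<in> {0..p} \<Longrightarrow> \<sigma> * u (y, 0) \<le> 0"
      by (simp add: trace_vanishes)
    assume y: "y \<in> {0<..<p}" and "s \<in> {t..<0}"
    then have s: "s \<in> {-T<..<T}" "s \<in> {-T<..<0}" using t T_pos by auto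
    show "((\<lambda>y. \<sigma> * u (y, s)) has_real_derivative \<sigma> * ux (y, s)) (at y)"
         "((\<lambda>y. \<sigma> * ux (y, s)) has_real_derivative \<sigma> * uxx (y, s)) (at y)"
         "((\<lambda>s. \<sigma> * u (y, s)) has_real_derivative \<sigma> * ut (y, s)) (at s)"
      by (intro DERIV_cmult ux uxx ut y s)+
    show "\<sigma> * ut (y, s) + \<sigma> * uxx (y, s) = 0"
      by (simp add: heat[OF y s(2)])
  qed (use x t in auto)
  from nonpos[of 1] nonpos[of "-1"] show ?thesis by simp
qed

end

section \<open>Uniqueness for the mixed problem\<close>
lemma solves_P_has_derivatives:
  assumes "solves_P p T f u" and z: "x \<in> {0<..<p}" "t \<in> {-T<..<T}"
  shows "((\<lambda>y. u (y, t)) has_real_derivative Dx u (x, t)) (at x)"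
    and "((\<lambda>y. Dx u (y, t)) has_real_derivative Dx (Dx u) (x, t)) (at x)"
    and "((\<lambda>s. u (x, s)) has_real_derivative Dt u (x, t)) (at t)"
    and "((\<lambda>s. Dt u (x, s)) has_real_derivative Dt (Dt u) (x, t)) (at t)"
proof -
  have dx: "((\<lambda>y. g (y, t)) has_real_derivative Dx g (x, t)) (at x)"
    if "has_Dx_on g (Omega p T)" for g
    using that z unfolding has_Dx_on_def Omega_def
    by (auto simp: Dx_def DERIV_deriv_iff_real_differentiable)
  have dt: "((\<lambda>s. g (x, s)) has_real_derivative Dt g (x, t)) (at t)"
    if "has_Dt_on g (Omega p T)" for g
    using that z unfolding has_Dt_on_def Omega_def
    by (auto simp: Dt_def DERIV_deriv_iff_real_differentiable)
  have "C22_on (Omega p T) u" using assms(1) by (simp add: solves_P_def)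
  then show "((\<lambda>y. u (y, t)) has_real_derivative Dx u (x, t)) (at x)"
    and "((\<lambda>y. Dx u (y, t)) has_real_derivative Dx (Dx u) (x, t)) (at x)"
    and "((\<lambda>s. u (x, s)) has_real_derivative Dt u (x, t)) (at t)"
    and "((\<lambda>s. Dt u (x, s)) has_real_derivative Dt (Dt u) (x, t)) (at t)"
    by (auto simp: C22_on_def intro: dx dt)
qed

theorem theorem1:
  fixes p T :: real and f u1 u2 :: "real \<times> real \<Rightarrow> real"
  assumes "p > 0" and "T > 0"
    and "solves_P p T f u1" and "lateral_limits p T u1"
    and "solves_P p T f u2" and "lateral_limits p T u2"
  shows "\<forall>z\<in>closure (Omega p T). u1 z = u2 z"
proof -
  define u where "u = (\<lambda>z. u1 z - u2 z)"
  have Omega: "Omega p T = {0<..<p} \<times> {-T<..<T}" by (simp add: Omega_def)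
  have closure: "closure (Omega p T) = {0..p} \<times> {-T..T}"
    using assms(1,2) by (simp add: Omega closure_Times)
  have C22: "C22_on (Omega p T) u1" "C22_on (Omega p T) u2"
    using assms(3,5) by (auto simp: solves_P_def)
  have cont_closure: "continuous_on (closure (Omega p T)) u"
    using assms(3,5) unfolding u_def by (intro continuous_on_diff) (auto simp: solves_P_def)
  interpret homogeneous_solution p T u "\<lambda>z. Dx u1 z - Dx u2 z" "\<lambda>z. Dx (Dx u1) z - Dx (Dx u2) z"
    "\<lambda>z. Dt u1 z - Dt u2 z" "\<lambda>z. Dt (Dt u1) z - Dt (Dt u2) z"
  proof
    show "continuous_on ({0..p} \<times> {-T<..<T}) u"
      by (rule continuous_on_subset[OF cont_closure]) (auto simp: closure)
    fix x t
    show "t \<in> {-T<..<T} \<Longrightarrow> u (0, t) = 0" "t \<in> {-T<..<T} \<Longrightarrow> u (p, t) = 0"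
      using assms(3,5) by (auto simp: solves_P_def u_def)
    assume x: "x \<in> {0<..<p}"
    {
      assume t: "t \<in> {0<..<T}"
      then have "(x, t) \<in> Omega_pos p T"
        using x assms(2) by (auto simp: Omega_pos_def Omega)
      then have "Dt (Dt u1) (x, t) - Dx (Dx u1) (x, t) = Dt (Dt u2) (x, t) - Dx (Dx u2) (x, t)"
        using assms(3,5) by (simp add: solves_P_def)
      then show "Dt (Dt u1) (x, t) - Dt (Dt u2) (x, t) = Dx (Dx u1) (x, t) - Dx (Dx u2) (x, t)"
        by linarith
    next
      assume t: "t \<in> {-T<..<0}"
      then have "(x, t) \<in> Omega_neg p T"
        using x assms(2) by (auto simp: Omega_neg_def Omega)
      then have "Dt u1 (x, t) + Dx (Dx u1) (x, t) = Dt u2 (x, t) + Dx (Dx u2) (x, t)"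
        using assms(3,5) by (simp add: solves_P_def)
      then show "Dt u1 (x, t) - Dt u2 (x, t) = - (Dx (Dx u1) (x, t) - Dx (Dx u2) (x, t))"
        by linarith
    }
    assume t: "t \<in> {-T<..<T}"
    note d1 = solves_P_has_derivatives[OF assms(3) x t] and d2 = solves_P_has_derivatives[OF assms(5) x t]
    show "((\<lambda>y. u (y, t)) has_real_derivative Dx u1 (x, t) - Dx u2 (x, t)) (at x)"
      unfolding u_def by (rule DERIV_diff[OF d1(1) d2(1)])
    show "((\<lambda>y. Dx u1 (y, t) - Dx u2 (y, t)) has_real_derivative
             Dx (Dx u1) (x, t) - Dx (Dx u2) (x, t)) (at x)"
      by (rule DERIV_diff[OF d1(2) d2(2)])
    show "((\<lambda>s. u (x, s)) has_real_derivative Dt u1 (x, t) - Dt u2 (x, t)) (at t)"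
      unfolding u_def by (rule DERIV_diff[OF d1(3) d2(3)])
    show "((\<lambda>s. Dt u1 (x, s) - Dt u2 (x, s)) has_real_derivative
             Dt (Dt u1) (x, t) - Dt (Dt u2) (x, t)) (at t)"
      by (rule DERIV_diff[OF d1(4) d2(4)])
  next
    note C = C22[unfolded C22_on_def Omega]
    show "continuous_on ({0<..<p} \<times> {-T<..<T}) (\<lambda>z. Dx u1 z - Dx u2 z)"
         "continuous_on ({0<..<p} \<times> {-T<..<T}) (\<lambda>z. Dx (Dx u1) z - Dx (Dx u2) z)"
         "continuous_on ({0<..<p} \<times> {-T<..<T}) (\<lambda>z. Dt u1 z - Dt u2 z)"
         "continuous_on ({0<..<p} \<times> {-T<..<T}) (\<lambda>z. Dt (Dt u1) z - Dt (Dt u2) z)"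
      by (intro continuous_on_diff; use C in blast)+
  qed (use assms(1,2) in simp_all)
  have "u z = 0" if z_Omega: "z \<in> Omega p T" for z
  proof -
    obtain x t where z: "z = (x, t)" "x \<in> {0<..<p}" "t \<in> {-T<..<T}"
      using z_Omega unfolding Omega by blast
    then show ?thesis
      using vanishes_after[of x t] vanishes_before[of x t] by (cases "t \<ge> 0") auto
  qed
  then have "u z = 0" if "z \<in> closure (Omega p T)" for z
    using continuous_constant_on_closure[OF cont_closure] that by blast
  then show ?thesis by (simp add: u_def)
qed

end
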